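(* Let $F\subset\mathbb{P}^2_{\mathbb{C}}$ be the Fermat cubic $x^3+y^3+z^3=0$. Then every type $9$ point on $F$ has homogeneous coordinates in the field $\mathbb{Q}(\alpha,\beta)$, where $\alpha=\sqrt[3]{3}$ and $\beta$ is a primitive root of unity of order $9$; that is, each type $9$ point can be written as $[a:b:c]$ with $a,b,c\in\mathbb{Q}(\alpha,\beta)$.
   Context: Equip the smooth plane cubic $F$ with its group law having a flex point as origin, so that three points of $F$ sum to zero if and only if they are the intersection (with multiplicity) of $F$ with a line. The flex points are then exactly the points $P$ with $3P=0$. A type $9$ point on $F$ is a point $P\in F$ that is $9$-torsion but not $3$-torsion (i.e. $9P=0$, $3P\neq 0$); this does not depend on the choice of flex as origin. *)

theory Defs
  imports
    "HOL-Analysis.Analysis"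
    "HOL-Computational_Algebra.Polynomial"
    "HOL-Algebra.Generated_Fields"
    "HOL-Algebra.Algebraic_Closure_Type"
begin

text \<open>The symbol \<open>$\<close> is kept for vector components only.\<close>

no_notation fps_nth (infixl \<open>$\<close> 75)

text \<open>
  The complex projective plane is the set of one-dimensional subspaces of \<open>\<complex>\<^sup>3\<close>, and its lines are the
  two-dimensional subspaces; incidence is inclusion. All linear algebra is over the complex
  numbers, hence the prefix \<open>vec\<close> (the unqualified \<open>span\<close> and \<open>dim\<close> are the real ones).
\<close>

definition homog :: "complex ^ 3 \<Rightarrow> (complex ^ 3) set" where
  "homog v = vec.span {v}"

definition proj_plane :: "(complex ^ 3) set set" where
  "proj_plane = {homog v | v. v \<noteq> 0}"

definition proj_lines :: "(complex ^ 3) set set" where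
  "proj_lines = {L. vec.subspace L \<and> vec.dim L = 2}"

definition fermat_form :: "'a::comm_ring_1 \<Rightarrow> 'a \<Rightarrow> 'a \<Rightarrow> 'a" where
  "fermat_form x y z = x ^ 3 + y ^ 3 + z ^ 3"

definition fermat_cubic :: "(complex ^ 3) set set" where
  "fermat_cubic = {homog v | v. v \<noteq> 0 \<and> fermat_form (v $ 1) (v $ 2) (v $ 3) = 0}"

text \<open>The polynomial \<open>F(v + t w)\<close> in \<open>t\<close>, for \<open>F = x\<^sup>3 + y\<^sup>3 + z\<^sup>3\<close>:\<close>

definition fermat_along :: "complex ^ 3 \<Rightarrow> complex ^ 3 \<Rightarrow> complex poly" where
  "fermat_along v w = fermat_form [:v $ 1, w $ 1:] [:v $ 2, w $ 2:] [:v $ 3, w $ 3:]"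

text \<open>
  The intersection multiplicity of the line \<open>L\<close> with the Fermat cubic at the point \<open>Z\<close> is the
  vanishing order at \<open>Z\<close> of the form restricted to \<open>L\<close>, where \<open>t \<mapsto> [v + t w]\<close> is any
  parametrisation of \<open>L\<close> with \<open>[v] = Z\<close>. Lemma \<open>intersection_mult_eq\<close> below shows that the choice
  does not matter. No line is contained in the cubic, so the order is always
  that of a nonzero polynomial.
\<close>

definition intersection_mult :: "(complex ^ 3) set \<Rightarrow> (complex ^ 3) set \<Rightarrow> nat" where
  "intersection_mult L Z =
     (if Z \<subseteq> L
      then THE m. \<forall>v w. Z = homog v \<and> w \<in> L \<and> w \<notin> Z \<longrightarrow>
             m = Polynomial.order 0 (fermat_along v w)
      else 0)"

text \<open>The intersection of the cubic with \<open>L\<close>, counted with multiplicity, is the multiset \<open>M\<close>:\<close>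

definition line_section :: "(complex ^ 3) set \<Rightarrow> (complex ^ 3) set multiset \<Rightarrow> bool" where
  "line_section L M \<longleftrightarrow> (\<forall>Z\<in>proj_plane. intersection_mult L Z = count M Z)"

definition fermat_flex :: "(complex ^ 3) set \<Rightarrow> bool" where
  "fermat_flex P \<longleftrightarrow> P \<in> fermat_cubic \<and> (\<exists>L\<in>proj_lines. intersection_mult L P \<ge> 3)"

text \<open>
  The group law on the Fermat cubic with a flex point as origin. It is written multiplicatively,
  as always in HOL-Algebra, and for each choice of flex it is determined by these conditions:
  the last clause says that three points sum to zero iff they are the intersection, with
  multiplicity, of the cubic with a line.
\<close>

definition fermat_group_law :: "(complex ^ 3) set monoid \<Rightarrow> bool" where
  "fermat_group_law G \<longleftrightarrow>
     comm_group G \<and>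
     carrier G = fermat_cubic \<and>
     fermat_flex \<one>\<^bsub>G\<^esub> \<and>
     (\<forall>P\<in>fermat_cubic. \<forall>Q\<in>fermat_cubic. \<forall>R\<in>fermat_cubic.
        P \<otimes>\<^bsub>G\<^esub> Q \<otimes>\<^bsub>G\<^esub> R = \<one>\<^bsub>G\<^esub> \<longleftrightarrow> (\<exists>L\<in>proj_lines. line_section L {#P, Q, R#}))"

definition type9_point :: "(complex ^ 3) set monoid \<Rightarrow> (complex ^ 3) set \<Rightarrow> bool" where
  "type9_point G P \<longleftrightarrow>
     P \<in> fermat_cubic \<and> P [^]\<^bsub>G\<^esub> (9::nat) = \<one>\<^bsub>G\<^esub> \<and> P [^]\<^bsub>G\<^esub> (3::nat) \<noteq> \<one>\<^bsub>G\<^esub>"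

definition primitive_root_of_unity :: "nat \<Rightarrow> complex \<Rightarrow> bool" where
  "primitive_root_of_unity n \<zeta> \<longleftrightarrow> n > 0 \<and> \<zeta> ^ n = 1 \<and> (\<forall>k. 0 < k \<and> k < n \<longrightarrow> \<zeta> ^ k \<noteq> 1)"

text \<open>The subfield of \<open>\<complex>\<close> generated by \<open>S\<close>; it contains \<open>\<rat>\<close>, so this is \<open>\<rat>(S)\<close>.\<close>

definition rat_adjoin :: "complex set \<Rightarrow> complex set" where
  "rat_adjoin S = generate_field ring_of_type_algebra S"

lemma fermat_along_coeffs:
  "fermat_along v w =
     [: v$1^3 + v$2^3 + v$3^3,
        3 * (v$1^2 * w$1 + v$2^2 * w$2 + v$3^2 * w$3),
        3 * (v$1 * w$1^2 + v$2 * w$2^2 + v$3 * w$3^2),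
        w$1^3 + w$2^3 + w$3^3 :]"
  by (simp add: fermat_along_def fermat_form_def power3_eq_cube power2_eq_square algebra_simps)

lemma order_0_cubic:
  fixes a b c d :: complex
  assumes "[:a, b, c, d:] \<noteq> 0"
  shows "Polynomial.order 0 [:a, b, c, d:] =
           (if a \<noteq> 0 then 0 else if b \<noteq> 0 then 1 else if c \<noteq> 0 then 2 else 3)"
proof -
  have shift: "Polynomial.order 0 (pCons 0 p) = Suc (Polynomial.order 0 p)"
    if "p \<noteq> 0" for p :: "complex poly"
  proof -
    have "pCons 0 p = [:- 0, 1:] * p" by simp
    moreover have "[:- 0, 1:] * p \<noteq> 0" using that by simp
    ultimately show ?thesis
      using order_mult[of "[:- 0, 1:]" p 0] order_power_n_n[of "0::complex" 1] by simp
  qed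
  have base: "Polynomial.order 0 (pCons x p) = 0" if "x \<noteq> 0" for x and p :: "complex poly"
    using that by (intro order_0I) simp
  show ?thesis using assms by (auto simp: shift base numeral_eq_Suc)
qed

lemma order_fermat_along_reparametrise:
  assumes v': "v' = c *s v" and w': "w' = a *s v + b *s w" and "c \<noteq> 0" "b \<noteq> 0"
  shows "Polynomial.order 0 (fermat_along v' w') = Polynomial.order 0 (fermat_along v w)"
proof -
  define A where "A = v$1^3 + v$2^3 + v$3^3"
  define B where "B = 3 * (v$1^2 * w$1 + v$2^2 * w$2 + v$3^2 * w$3)"
  define C where "C = 3 * (v$1 * w$1^2 + v$2 * w$2^2 + v$3 * w$3^2)"
  define D where "D = w$1^3 + w$2^3 + w$3^3"
  have old: "fermat_along v w = [:A, B, C, D:]"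
    by (simp add: fermat_along_coeffs A_def B_def C_def D_def)
  have new: "fermat_along v' w' =
      [: c^3 * A, 3 * c^2 * a * A + c^2 * b * B,
         3 * c * a^2 * A + 2 * c * a * b * B + c * b^2 * C,
         a^3 * A + a^2 * b * B + a * b^2 * C + b^3 * D :]"
    unfolding fermat_along_coeffs v' w' A_def B_def C_def D_def
    by (simp add: power3_eq_cube power2_eq_square algebra_simps)
  show ?thesis
  proof (cases "fermat_along v w = 0")
    case True
    then have "fermat_along v' w' = 0" unfolding old new by auto
    with True show ?thesis by simp
  next
    case False
    then have "fermat_along v' w' \<noteq> 0" using \<open>c \<noteq> 0\<close> \<open>b \<noteq> 0\<close> unfolding old new by auto
    with False show ?thesis using \<open>c \<noteq> 0\<close> \<open>b \<noteq> 0\<close> unfolding old new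
      by (auto simp: order_0_cubic)
  qed
qed

lemma proj_line_spanned:
  assumes L: "L \<in> proj_lines" and v: "v \<in> L" "v \<noteq> 0" and w: "w \<in> L" "w \<notin> homog v"
  shows "L = vec.span {v, w}"
proof -
  have ne: "w \<noteq> v" using w(2) vec.span_base[of v "{v}"] by (auto simp: homog_def)
  have ind: "vec.independent {w, v}"
    using v(2) w(2) by (auto simp: vec.independent_insert homog_def)
  have "vec.dim L = 2" using L by (simp add: proj_lines_def)
  then have "L \<subseteq> vec.span {w, v}"
    using vec.card_ge_dim_independent[of "{w, v}" L] ind v(1) w(1) ne by simp
  moreover have "vec.span {w, v} \<subseteq> L"
    using L v(1) w(1) by (intro vec.span_minimal) (auto simp: proj_lines_def)
  ultimately show ?thesis by (simp add: insert_commute)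
qed

lemma intersection_mult_eq:
  assumes L: "L \<in> proj_lines" and v: "v \<in> L" "v \<noteq> 0" and w: "w \<in> L" "w \<notin> homog v"
  shows "intersection_mult L (homog v) = Polynomial.order 0 (fermat_along v w)"
proof -
  have sub: "homog v \<subseteq> L"
    using L v(1) unfolding homog_def by (intro vec.span_minimal) (auto simp: proj_lines_def)
  have same: "Polynomial.order 0 (fermat_along v' w') = Polynomial.order 0 (fermat_along v w)"
    if v': "homog v = homog v'" and w': "w' \<in> L" "w' \<notin> homog v" for v' w'
  proof -
    have "v' \<in> vec.span {v}" using v' vec.span_base[of v' "{v'}"] by (auto simp: homog_def)
    then obtain c where c: "v' = c *s v" by (auto simp: vec.span_singleton)
    have "c \<noteq> 0"
    proof
      assume "c = 0"
      then have "homog v = {0}" using c v' by (simp add: homog_def)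
      moreover have "v \<in> homog v" by (simp add: homog_def vec.span_base)
      ultimately show False using v(2) by simp
    qed
    have "w' \<in> vec.span {w, v}"
      using proj_line_spanned[OF L v w] w'(1) by (simp add: insert_commute)
    then obtain b where "w' - b *s w \<in> vec.span {v}"
      by (auto simp: vec.span_insert)
    then obtain a where "w' - b *s w = a *s v" by (auto simp: vec.span_singleton)
    then have wab: "w' = a *s v + b *s w" by (simp add: algebra_simps)
    have "b \<noteq> 0" using w'(2) wab by (auto simp: homog_def vec.span_singleton)
    show ?thesis
      by (rule order_fermat_along_reparametrise[OF c wab \<open>c \<noteq> 0\<close> \<open>b \<noteq> 0\<close>])
  qed
  have "(THE m. \<forall>v' w'. homog v = homog v' \<and> w' \<in> L \<and> w' \<notin> homog v \<longrightarrow>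
           m = Polynomial.order 0 (fermat_along v' w')) = Polynomial.order 0 (fermat_along v w)"
    using same w by (intro the_equality) (metis, blast)
  then show ?thesis using sub by (simp add: intersection_mult_def)
qed

end

theory Submission
  imports Defs
begin

text \<open>
  The group law is used only through four line sections. Write \<open>O\<close> for the origin, and let \<open>P\<close> be a
  type 9 point. Then \<open>T = 3P\<close> satisfies \<open>T + T + T = O\<close> and \<open>T \<noteq> O\<close>, so \<open>O\<close> and \<open>T\<close> are two different
  flexes. The triples \<open>(O, P, -P)\<close> and \<open>(T, -P, -2P)\<close> sum to zero and consist of distinct points; so
  \<open>-2P\<close> arises from \<open>P\<close> by projecting the cubic to itself first from \<open>O\<close>, then from \<open>T\<close>. The flexes lie on \<open>xyz = 0\<close>
  (\<open>flex_vanishing_coordinate\<close>), and projection from the flex \<open>[0 : 1 : -e]\<close>, where \<open>e\<^sup>3 = 1\<close>, is the linear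
  map \<open>[x : y : z] \<mapsto> [x : e\<^sup>2z : ey]\<close> (\<open>chord_through_flex\<close>), with the analogous maps for the
  other two coordinates. Therefore \<open>-2P\<close> is the image of \<open>P\<close> under the composite of two such maps,
  which is, up to cube roots of unity, either diagonal or a cyclic permutation of the coordinates
  (\<open>flex_reflected_twice\<close>).

  The remaining relation \<open>P + P - 2P = O\<close> says that \<open>-2P\<close> lies on the tangent at \<open>P\<close>. As \<open>-2P\<close> is now a linear
  function of \<open>P\<close>, this is one further cubic equation in the coordinates of \<open>P\<close>
  (\<open>type9_point_tangent_condition\<close>), so \<open>P\<close> is one of nine points of the intersection of two cubics.
  In the diagonal case the second cubic is \<open>x\<^sup>3 + \<eta>y\<^sup>3 + \<eta>\<^sup>2z\<^sup>3 = 0\<close>, whence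
  \<open>x\<^sup>3 : y\<^sup>3 : z\<^sup>3 = 1 : \<eta> : \<eta>\<^sup>2\<close>, which needs only \<open>\<beta>\<close>. In the cyclic case rescaling by cube roots of
  unity makes it \<open>x\<^sup>2y + y\<^sup>2z + z\<^sup>2x = 0\<close>; this is the case that needs \<open>\<alpha>\<close>, and it is solved in
  \<open>cyclic_intersection_rational\<close>.
\<close>

section \<open>The field \<open>\<rat>(\<alpha>, \<beta>)\<close>\<close>

lemma rat_adjoin_incl: "s \<in> S \<Longrightarrow> s \<in> rat_adjoin S"
  unfolding rat_adjoin_def by (rule generate_field.incl)

lemma rat_adjoin_1: "1 \<in> rat_adjoin S"
  unfolding rat_adjoin_def
  using generate_field.one[of ring_of_type_algebra S] by (simp add: ring_of_type_algebra_def)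

lemma rat_adjoin_add: "a \<in> rat_adjoin S \<Longrightarrow> b \<in> rat_adjoin S \<Longrightarrow> a + b \<in> rat_adjoin S"
  unfolding rat_adjoin_def
  using generate_field.eng_add[of a ring_of_type_algebra S b] by (simp add: ring_of_type_algebra_def)

lemma rat_adjoin_mult: "a \<in> rat_adjoin S \<Longrightarrow> b \<in> rat_adjoin S \<Longrightarrow> a * b \<in> rat_adjoin S"
  unfolding rat_adjoin_def
  using generate_field.eng_mult[of a ring_of_type_algebra S b] by (simp add: ring_of_type_algebra_def)

lemma rat_adjoin_uminus:
  assumes "a \<in> rat_adjoin S"
  shows "- a \<in> rat_adjoin S"
proof -
  interpret field "ring_of_type_algebra :: complex ring" by (rule field_from_type_algebra)
  have "\<ominus>\<^bsub>ring_of_type_algebra\<^esub> a = - a"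
    by (rule minus_equality) (auto simp: ring_of_type_algebra_def)
  then show ?thesis
    using assms generate_field.a_inv[of a ring_of_type_algebra S] by (simp add: rat_adjoin_def)
qed

lemma rat_adjoin_inverse:
  assumes "a \<in> rat_adjoin S"
  shows "inverse a \<in> rat_adjoin S"
proof (cases "a = 0")
  case False
  interpret field "ring_of_type_algebra :: complex ring" by (rule field_from_type_algebra)
  have "inv\<^bsub>ring_of_type_algebra\<^esub> a = inverse a"
    by (rule comm_inv_char) (use False in \<open>auto simp: ring_of_type_algebra_def\<close>)
  then show ?thesis
    using assms False generate_field.m_inv[of a ring_of_type_algebra S]
    by (simp add: rat_adjoin_def ring_of_type_algebra_def)
qed (use assms in simp)

lemma rat_adjoin_diff: "a \<in> rat_adjoin S \<Longrightarrow> b \<in> rat_adjoin S \<Longrightarrow> a - b \<in> rat_adjoin S"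
  using rat_adjoin_add[of a S "- b"] by (simp add: rat_adjoin_uminus)

lemma rat_adjoin_divide: "a \<in> rat_adjoin S \<Longrightarrow> b \<in> rat_adjoin S \<Longrightarrow> a / b \<in> rat_adjoin S"
  by (simp add: divide_inverse rat_adjoin_mult rat_adjoin_inverse)

lemma rat_adjoin_0: "0 \<in> rat_adjoin S"
  using rat_adjoin_diff[OF rat_adjoin_1 rat_adjoin_1] by simp

lemma rat_adjoin_power: "a \<in> rat_adjoin S \<Longrightarrow> a ^ n \<in> rat_adjoin S"
  by (induction n) (simp_all add: rat_adjoin_1 rat_adjoin_mult)

lemma rat_adjoin_numeral: "numeral n \<in> rat_adjoin S"
  by (induction n) (simp_all only: numeral.simps numeral_One rat_adjoin_1 rat_adjoin_add)

lemmas rat_adjoin_closed =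
  rat_adjoin_0 rat_adjoin_1 rat_adjoin_numeral rat_adjoin_add rat_adjoin_mult rat_adjoin_uminus
  rat_adjoin_diff rat_adjoin_inverse rat_adjoin_divide rat_adjoin_power

lemma primitive_9th_root_cyclotomic:
  assumes "primitive_root_of_unity 9 \<beta>"
  shows "\<beta> ^ 6 + \<beta> ^ 3 + 1 = 0"
proof -
  have "\<beta> ^ 9 = 1" "\<beta> ^ 3 \<noteq> 1"
    using assms by (auto simp: primitive_root_of_unity_def)
  moreover have "(\<beta> ^ 3 - 1) * (\<beta> ^ 6 + \<beta> ^ 3 + 1) = \<beta> ^ 9 - 1" by Groebner_Basis.algebra
  ultimately show ?thesis by simp
qed

lemma cube_root_of_unity_cases:
  fixes e \<beta> :: complex
  assumes "\<beta> ^ 6 + \<beta> ^ 3 + 1 = 0" and "e ^ 3 = 1"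
  shows "e = 1 \<or> e = \<beta> ^ 3 \<or> e = \<beta> ^ 6"
proof -
  have "(e - 1) * (e - \<beta> ^ 3) * (e - \<beta> ^ 6) = 0" using assms by Groebner_Basis.algebra
  then show ?thesis by simp
qed

lemma cube_root_of_unity_in_field:
  assumes "\<beta> ^ 6 + \<beta> ^ 3 + 1 = 0" and "\<beta> \<in> rat_adjoin S" and "e ^ 3 = 1"
  shows "e \<in> rat_adjoin S"
  using cube_root_of_unity_cases[OF assms(1,3)] assms(2) by (auto simp: rat_adjoin_closed)

text \<open>
  One root is \<open>B = -(\<beta> + 1/\<beta>)\<close>, by the triple angle formula. The cubic is cyclic: the map
  \<open>A \<mapsto> 2 - A\<^sup>2\<close>, which doubles the angle up to sign, permutes its roots, so all three of them are
  polynomials in \<open>B\<close>.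
\<close>

lemma real_subfield_root_in_field:
  fixes A \<beta> :: complex
  assumes \<beta>: "\<beta> ^ 6 + \<beta> ^ 3 + 1 = 0" "\<beta> \<in> rat_adjoin S"
    and A: "A ^ 3 = 3 * A + 1"
  shows "A \<in> rat_adjoin S"
proof -
  define B where "B = - (\<beta> + \<beta> ^ 8)"
  have "\<beta> ^ 9 = 1" using \<beta>(1) by Groebner_Basis.algebra
  then have B: "B ^ 3 = 3 * B + 1" unfolding B_def using \<beta>(1) by Groebner_Basis.algebra
  have "B \<in> rat_adjoin S" unfolding B_def using \<beta>(2) by (simp add: rat_adjoin_closed)
  moreover have "(A - B) * (A - (2 - B ^ 2)) * (A - (B ^ 2 - B - 2)) = 0"
    using A B by Groebner_Basis.algebra
  then have "A = B \<or> A = 2 - B ^ 2 \<or> A = B ^ 2 - B - 2" by simp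
  ultimately show ?thesis by (auto simp: rat_adjoin_closed)
qed

section \<open>Solving the two cubic equations\<close>

text \<open>
  After scaling to \<open>y = 1\<close>, with affine coordinates \<open>u = x\<close> and \<open>w = z\<close>, the ratio \<open>A = u\<^sup>2/w\<close> of the
  first two terms of the cyclic equation satisfies \<open>A\<^sup>3 = 3A + 1\<close>, so it lies in \<open>\<rat>(\<beta>)\<close>. Moreover
  \<open>u\<^sup>3 = -A(A + 1)\<close> is a unit, and it remains to extract its cube root. With \<open>A' = 2 - A\<^sup>2\<close> and
  \<open>C = A\<^sup>2 - A - 2\<close> for the conjugates of \<open>A\<close> one has \<open>A + 1 = -AA'\<close> and \<open>A - 2 = -C\<^sup>2\<close>, hence
  \<open>u\<^sup>3 = A\<^sup>2A'\<close>, while the prime \<open>A - 1\<close> above 3 satisfies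
  \<open>(A - 1)\<^sup>3 = 3A(2 - A) = 3AC\<^sup>2\<close>. As \<open>AA'C = 1\<close>, this is \<open>(A - 1)\<^sup>3 = 3u\<^sup>3C\<^sup>3\<close>, so \<open>u\<close> is
  \<open>(A - 1)/(\<alpha>C)\<close> up to a cube root of unity.
\<close>

lemma cyclic_intersection_rational:
  fixes x y z \<alpha> \<beta> :: complex
  assumes \<alpha>: "\<alpha> ^ 3 = 3" "\<alpha> \<in> rat_adjoin S"
    and \<beta>: "\<beta> ^ 6 + \<beta> ^ 3 + 1 = 0" "\<beta> \<in> rat_adjoin S"
    and nz: "x \<noteq> 0 \<or> y \<noteq> 0 \<or> z \<noteq> 0"
    and F: "x ^ 3 + y ^ 3 + z ^ 3 = 0"
    and T: "x ^ 2 * y + y ^ 2 * z + z ^ 2 * x = 0"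
  shows "\<exists>s. s \<noteq> 0 \<and> s * x \<in> rat_adjoin S \<and> s * y \<in> rat_adjoin S \<and> s * z \<in> rat_adjoin S"
proof -
  have y: "y \<noteq> 0" using nz F T by auto
  define u and w where "u = x / y" and "w = z / y"
  have xz: "x = u * y" "z = w * y" using y by (simp_all add: u_def w_def)
  have "y ^ 3 * (u ^ 3 + 1 + w ^ 3) = 0" "y ^ 3 * (u ^ 2 + w + w ^ 2 * u) = 0"
    using F T unfolding xz by Groebner_Basis.algebra+
  then have F': "u ^ 3 + 1 + w ^ 3 = 0" and T': "u ^ 2 + w + w ^ 2 * u = 0" using y by auto
  have w: "w \<noteq> 0" using F' T' by auto
  have u: "u \<noteq> 0" using T' w by auto
  define A where "A = u ^ 2 / w"
  have Aw: "A * w = u ^ 2" using w by (simp add: A_def)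
  have A0: "A \<noteq> 0" using Aw u by auto
  have "w * (A + 1 + u * w) = 0" using Aw T' by Groebner_Basis.algebra
  then have A1: "A + 1 + u * w = 0" using w by simp
  then have "A + 1 \<noteq> 0" using u w by auto
  have u3: "u ^ 3 = - A * (A + 1)" using A1 Aw by Groebner_Basis.algebra
  have "(A + 1) * (A ^ 3 - 3 * A - 1) = 0" using A1 u3 F' by Groebner_Basis.algebra
  with \<open>A + 1 \<noteq> 0\<close> have "A ^ 3 - 3 * A - 1 = 0" by (simp only: mult_eq_0_iff simp_thms)
  then have A3: "A ^ 3 = 3 * A + 1" by Groebner_Basis.algebra
  have AK: "A \<in> rat_adjoin S" by (rule real_subfield_root_in_field[OF \<beta> A3])
  define C where "C = A ^ 2 - A - 2"
  have "3 * (- A * (A + 1)) * C ^ 3 = (A - 1) ^ 3" unfolding C_def using A3 by Groebner_Basis.algebra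
  then have cube: "(u * \<alpha> * C) ^ 3 = (A - 1) ^ 3"
    using u3 \<alpha>(1) by (simp add: power_mult_distrib mult_ac)
  have "A \<noteq> 1" using A3 by auto
  then have nz': "u * \<alpha> * C \<noteq> 0" using cube by auto
  define e where "e = u * \<alpha> * C / (A - 1)"
  have "e ^ 3 = 1" using cube \<open>A \<noteq> 1\<close> by (simp add: e_def power_divide)
  then have eK: "e \<in> rat_adjoin S" by (rule cube_root_of_unity_in_field[OF \<beta>])
  have CK: "C \<in> rat_adjoin S" unfolding C_def using AK by (simp add: rat_adjoin_closed)
  have "u = e * (A - 1) / (\<alpha> * C)" using nz' \<open>A \<noteq> 1\<close> by (simp add: e_def field_simps)
  then have uK: "u \<in> rat_adjoin S" using eK AK CK \<alpha>(2) by (simp add: rat_adjoin_closed)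
  have "w = u ^ 2 / A" using A0 Aw by (simp add: field_simps)
  then have "w \<in> rat_adjoin S" using uK AK by (simp add: rat_adjoin_closed)
  then show ?thesis
    using uK y unfolding u_def w_def
    by (intro exI[of _ "1 / y"]) (simp add: rat_adjoin_closed)
qed

text \<open>
  The substitution \<open>(x, y, z) \<mapsto> (x, ay, abz)\<close> preserves the Fermat form and removes the
  coefficients of the second equation.
\<close>

lemma twisted_cyclic_intersection_rational:
  fixes x y z a b c \<alpha> \<beta> :: complex
  assumes \<alpha>: "\<alpha> ^ 3 = 3" "\<alpha> \<in> rat_adjoin S"
    and \<beta>: "\<beta> ^ 6 + \<beta> ^ 3 + 1 = 0" "\<beta> \<in> rat_adjoin S"
    and nz: "x \<noteq> 0 \<or> y \<noteq> 0 \<or> z \<noteq> 0"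
    and F: "x ^ 3 + y ^ 3 + z ^ 3 = 0"
    and abc: "a ^ 3 = 1" "b ^ 3 = 1" "a * b * c = 1"
    and T: "a * (x ^ 2 * y) + b * (y ^ 2 * z) + c * (z ^ 2 * x) = 0"
  shows "\<exists>s. s \<noteq> 0 \<and> s * x \<in> rat_adjoin S \<and> s * y \<in> rat_adjoin S \<and> s * z \<in> rat_adjoin S"
proof -
  have ab0: "a \<noteq> 0" "b \<noteq> 0" using abc(3) by auto
  have "x \<noteq> 0 \<or> a * y \<noteq> 0 \<or> a * b * z \<noteq> 0" using nz ab0 by auto
  moreover have "x ^ 3 + (a * y) ^ 3 + (a * b * z) ^ 3 = 0"
    using F abc(1,2) by (simp add: power_mult_distrib)
  moreover have "c = a ^ 2 * b ^ 2" using abc by Groebner_Basis.algebra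
  then have "x ^ 2 * (a * y) + (a * y) ^ 2 * (a * b * z) + (a * b * z) ^ 2 * x = 0"
    using T abc(1) by Groebner_Basis.algebra
  ultimately obtain s where s: "s \<noteq> 0" "s * x \<in> rat_adjoin S" "s * (a * y) \<in> rat_adjoin S"
      "s * (a * b * z) \<in> rat_adjoin S"
    using cyclic_intersection_rational[OF \<alpha> \<beta>] by blast
  have "a \<in> rat_adjoin S" "b \<in> rat_adjoin S"
    using abc(1,2) cube_root_of_unity_in_field[OF \<beta>] by auto
  then have "s * (a * y) / a \<in> rat_adjoin S" "s * (a * b * z) / (a * b) \<in> rat_adjoin S"
    using s by (simp_all only: rat_adjoin_closed)
  with s ab0 show ?thesis by auto
qed

text \<open>
  The two equations are linear in the cubes and give \<open>x\<^sup>3 : y\<^sup>3 : z\<^sup>3 = 1 : \<eta> : \<eta>\<^sup>2\<close>; the primitive cube root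
  of unity \<open>\<eta>\<close> is \<open>\<beta>\<^sup>3\<close> or \<open>\<beta>\<^sup>6\<close>, so it is a cube in the field.
\<close>

lemma diagonal_intersection_rational:
  fixes x y z \<eta> \<beta> :: complex
  assumes \<beta>: "\<beta> ^ 6 + \<beta> ^ 3 + 1 = 0" "\<beta> \<in> rat_adjoin S"
    and nz: "x \<noteq> 0 \<or> y \<noteq> 0 \<or> z \<noteq> 0"
    and F: "x ^ 3 + y ^ 3 + z ^ 3 = 0"
    and \<eta>: "\<eta> ^ 3 = 1" "\<eta> \<noteq> 1"
    and T: "x ^ 3 + \<eta> * y ^ 3 + \<eta> ^ 2 * z ^ 3 = 0"
  shows "\<exists>s. s \<noteq> 0 \<and> s * x \<in> rat_adjoin S \<and> s * y \<in> rat_adjoin S \<and> s * z \<in> rat_adjoin S"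
proof -
  have "\<beta> \<noteq> 0" using \<beta>(1) by auto
  have b9: "\<beta> ^ 9 = 1" using \<beta>(1) by Groebner_Basis.algebra
  have "(\<eta> - 1) * (\<eta> ^ 2 + \<eta> + 1) = 0" using \<eta>(1) by Groebner_Basis.algebra
  then have \<eta>2: "\<eta> ^ 2 + \<eta> + 1 = 0" using \<eta>(2) by simp
  have "(\<eta> - 1) * (y ^ 3 - \<eta> * x ^ 3) = 0" "(\<eta> - 1) * (z ^ 3 - \<eta> ^ 2 * x ^ 3) = 0"
    using F T \<eta>2 by Groebner_Basis.algebra+
  then have yz: "y ^ 3 = \<eta> * x ^ 3" "z ^ 3 = \<eta> ^ 2 * x ^ 3" using \<eta>(2) by auto
  have x: "x \<noteq> 0" using nz yz by auto
  \<comment> \<open>A cube root of \<open>\<gamma>\<^sup>3\<close> differs from \<open>\<gamma>\<close> by a cube root of unity.\<close>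
  have root: "r \<in> rat_adjoin S" if "r ^ 3 = \<gamma> ^ 3" "\<gamma> \<in> {\<beta>, \<beta> ^ 2, \<beta> ^ 4}" for r \<gamma>
  proof -
    have "\<gamma> \<noteq> 0" "\<gamma> \<in> rat_adjoin S" using that(2) \<open>\<beta> \<noteq> 0\<close> \<beta>(2) by (auto simp: rat_adjoin_closed)
    moreover have "(r / \<gamma>) ^ 3 = 1" using that(1) \<open>\<gamma> \<noteq> 0\<close> by (simp add: power_divide)
    then have "r / \<gamma> \<in> rat_adjoin S" by (rule cube_root_of_unity_in_field[OF \<beta>])
    ultimately have "r / \<gamma> * \<gamma> \<in> rat_adjoin S" by (intro rat_adjoin_mult)
    then show ?thesis using \<open>\<gamma> \<noteq> 0\<close> by simp
  qed
  have yz': "(y / x) ^ 3 = \<eta>" "(z / x) ^ 3 = \<eta> ^ 2" using yz x by (simp_all add: power_divide)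
  consider "\<eta> = \<beta> ^ 3" | "\<eta> = \<beta> ^ 6" using cube_root_of_unity_cases[OF \<beta>(1) \<eta>(1)] \<eta>(2) by auto
  then have "y / x \<in> rat_adjoin S \<and> z / x \<in> rat_adjoin S"
  proof cases
    case 1
    then show ?thesis using yz' root[of "y / x" \<beta>] root[of "z / x" "\<beta> ^ 2"]
      by (simp flip: power_mult)
  next
    case 2
    then show ?thesis using yz' root[of "y / x" "\<beta> ^ 2"] root[of "z / x" "\<beta> ^ 4"]
      by (simp flip: power_mult)
  qed
  then show ?thesis using x by (intro exI[of _ "1 / x"]) (simp add: rat_adjoin_closed)
qed

section \<open>Projection from a flex\<close>

text \<open>
  The point \<open>(p, q, r)\<close> of the cubic is the combination \<open>s \<cdot> f + t \<cdot> (x, y, z)\<close> of the flex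
  \<open>f = (0, f2, f3)\<close> and a second point. Since \<open>f\<close> and \<open>(x, y, z)\<close> lie on the cubic, the Fermat form of
  this combination is \<open>3st\<close> times a linear form in \<open>s\<close> and \<open>t\<close>. The zero of that linear form determines
  \<open>s : t\<close>, unless the linear form vanishes at \<open>t = 0\<close>; in the latter case \<open>(x, y, z)\<close> would be
  proportional to \<open>f\<close>.
\<close>

lemma chord_through_flex:
  fixes f2 f3 x y z p q r s t :: complex
  assumes f: "f2 ^ 3 + f3 ^ 3 = 0" "f2 \<noteq> 0"
    and F: "x ^ 3 + y ^ 3 + z ^ 3 = 0" "p ^ 3 + q ^ 3 + r ^ 3 = 0"
    and pqr: "p = t * x" "q = s * f2 + t * y" "r = s * f3 + t * z"
    and st: "s \<noteq> 0" "t \<noteq> 0"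
    and ne: "\<And>k. \<not> (x = 0 \<and> y = k * f2 \<and> z = k * f3)"
  shows "\<exists>e. e ^ 3 = 1 \<and> p = t * x \<and> q = t * (e ^ 2 * z) \<and> r = t * (e * y)"
proof -
  define e where "e = - f3 / f2"
  have f3: "f3 = - e * f2" using f(2) by (simp add: e_def)
  have "f2 ^ 3 * (1 - e ^ 3) = 0" using f(1) f3 by Groebner_Basis.algebra
  then have e: "e ^ 3 = 1" using f(2) by simp
  define m where "m = s * f2"
  have q: "q = m + t * y" and r: "r = t * z - e * m" using pqr f3 by (simp_all add: m_def algebra_simps)
  have m: "m \<noteq> 0" using st f by (simp add: m_def)
  have "3 * m * t * (y + e ^ 2 * z) * (m + t * (y - e ^ 2 * z)) = 0"
    using F pqr(1) q r e by Groebner_Basis.algebra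
  moreover have "y + e ^ 2 * z \<noteq> 0"
  proof
    assume 0: "y + e ^ 2 * z = 0"
    then have "x ^ 3 = 0" using F(1) e by Groebner_Basis.algebra
    then have "x = 0" by simp
    moreover have "z = - e * y" using 0 e by Groebner_Basis.algebra
    ultimately show False using ne[of "y / f2"] f(2) f3 by simp
  qed
  ultimately have "m + t * (y - e ^ 2 * z) = 0" using m st by simp
  then have "q = t * (e ^ 2 * z)" "r = t * (e * y)" using q r e by Groebner_Basis.algebra+
  with e pqr(1) show ?thesis by blast
qed

text \<open>
  Projection from a flex, as a linear map, exchanges two coordinates up to a cube root of unity. The
  three alternatives correspond to the coordinate that vanishes at the flex, and the root \<open>e\<close> to the
  flex on that coordinate line.
\<close>

definition flex_reflected :: "complex ^ 3 \<Rightarrow> complex ^ 3 \<Rightarrow> bool" where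
  "flex_reflected v w \<longleftrightarrow> (\<exists>e. e ^ 3 = 1 \<and>
     (w = vector [v$1, e ^ 2 * v$3, e * v$2] \<or>
      w = vector [e ^ 2 * v$3, v$2, e * v$1] \<or>
      w = vector [e ^ 2 * v$2, e * v$1, v$3]))"

text \<open>
  The underlying permutation of coordinates is a product of two transpositions, so it is the identity
  or a 3-cycle; the coefficients have product 1 because \<open>e\<^sup>2 \<cdot> e = 1\<close> for each factor. In the
  diagonal case three cube roots of unity with product 1 form, after division by the first one, a
  geometric progression \<open>1, \<eta>, \<eta>\<^sup>2\<close>.
\<close>

lemma flex_reflected_twice:
  assumes "flex_reflected u v" "flex_reflected v w"
  obtains (diagonal) c \<eta> where "\<eta> ^ 3 = 1" "c \<noteq> 0" "w = c *s vector [u$1, \<eta> * u$2, \<eta> ^ 2 * u$3]"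
  | (cyclic) a b c where "a ^ 3 = 1" "b ^ 3 = 1" "c ^ 3 = 1" "a * b * c = 1"
      "w = vector [a * u$2, b * u$3, c * u$1]"
  | (anticyclic) a b c where "a ^ 3 = 1" "b ^ 3 = 1" "c ^ 3 = 1" "a * b * c = 1"
      "w = vector [a * u$3, b * u$1, c * u$2]"
proof -
  obtain e f where ef: "e ^ 3 = 1" "f ^ 3 = 1" and
    v: "v = vector [u$1, e ^ 2 * u$3, e * u$2] \<or> v = vector [e ^ 2 * u$3, u$2, e * u$1] \<or>
        v = vector [e ^ 2 * u$2, e * u$1, u$3]" and
    w: "w = vector [v$1, f ^ 2 * v$3, f * v$2] \<or> w = vector [f ^ 2 * v$3, v$2, f * v$1] \<or>
        w = vector [f ^ 2 * v$2, f * v$1, v$3]"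
    using assms unfolding flex_reflected_def by blast
  have e6: "e ^ 6 = 1" "f ^ 6 = 1" using ef by Groebner_Basis.algebra+
  have cubes: "1 ^ 3 = (1 :: complex)" "(e ^ 2) ^ 3 = 1" "(f ^ 2) ^ 3 = 1" "(f * e) ^ 3 = 1"
    "(f ^ 2 * e) ^ 3 = 1" "(f * e ^ 2) ^ 3 = 1" "(f ^ 2 * e ^ 2) ^ 3 = 1"
    using ef e6 by (simp_all add: power_mult_distrib flip: power_mult)
  have product: "e ^ 3 * f ^ 3 = 1" using ef by simp
  have diag: thesis if "w = vector [g1 * u$1, g2 * u$2, g3 * u$3]"
    "g1 ^ 3 = 1" "g2 ^ 3 = 1" "g1 * g2 * g3 = 1" for g1 g2 g3
  proof (rule diagonal[of "g2 / g1" g1])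
    show "(g2 / g1) ^ 3 = 1" "g1 \<noteq> 0" using that by (auto simp: power_divide)
    have "g3 = g1 * (g2 ^ 2 / g1 ^ 2)"
    proof -
      have "g1 * g3 = g2 ^ 2" using that(3,4) by Groebner_Basis.algebra
      then show ?thesis using \<open>g1 \<noteq> 0\<close> by (simp add: field_simps power2_eq_square)
    qed
    then show "w = g1 *s vector [u $ 1, g2 / g1 * u $ 2, (g2 / g1)\<^sup>2 * u $ 3]"
      using that \<open>g1 \<noteq> 0\<close> by (simp add: vec_eq_iff forall_3 power_divide)
  qed
  consider "w = vector [1 * u$1, f ^ 2 * e * u$2, f * e ^ 2 * u$3]"
    | "w = vector [f ^ 2 * e * u$2, e ^ 2 * u$3, f * u$1]"
    | "w = vector [f ^ 2 * e ^ 2 * u$3, f * u$1, e * u$2]"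
    | "w = vector [e ^ 2 * u$3, f ^ 2 * e * u$1, f * u$2]"
    | "w = vector [f ^ 2 * e * u$1, 1 * u$2, f * e ^ 2 * u$3]"
    | "w = vector [f ^ 2 * u$2, f * e ^ 2 * u$3, e * u$1]"
    | "w = vector [e ^ 2 * u$2, f ^ 2 * u$3, f * e * u$1]"
    | "w = vector [f ^ 2 * u$3, e * u$1, f * e ^ 2 * u$2]"
    | "w = vector [f ^ 2 * e * u$1, f * e ^ 2 * u$2, 1 * u$3]"
    using v w by (auto simp: mult_ac)
  then show thesis
  proof cases
    case 1
    show ?thesis by (rule diag[OF 1 cubes(1,5)]) 
      (use product in \<open>simp_all add: ef cubes power2_eq_square power3_eq_cube mult_ac\<close>)
  next
    case 2
    show ?thesis by (rule cyclic[OF cubes(5,2) ef(2) _ 2]) 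
      (use product in \<open>simp_all add: ef cubes power2_eq_square power3_eq_cube mult_ac\<close>)
  next
    case 3
    show ?thesis by (rule anticyclic[OF cubes(7) ef(2,1) _ 3]) 
      (use product in \<open>simp_all add: ef cubes power2_eq_square power3_eq_cube mult_ac\<close>)
  next
    case 4
    show ?thesis by (rule anticyclic[OF cubes(2,5) ef(2) _ 4]) 
      (use product in \<open>simp_all add: ef cubes power2_eq_square power3_eq_cube mult_ac\<close>)
  next
    case 5
    show ?thesis by (rule diag[OF 5 cubes(5,1)]) 
      (use product in \<open>simp_all add: ef cubes power2_eq_square power3_eq_cube mult_ac\<close>)
  next
    case 6
    show ?thesis by (rule cyclic[OF cubes(3,6) ef(1) _ 6]) 
      (use product in \<open>simp_all add: ef cubes power2_eq_square power3_eq_cube mult_ac\<close>)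
  next
    case 7
    show ?thesis by (rule cyclic[OF cubes(2,3,4) _ 7]) 
      (use product in \<open>simp_all add: ef cubes power2_eq_square power3_eq_cube mult_ac\<close>)
  next
    case 8
    show ?thesis by (rule anticyclic[OF cubes(3) ef(1) cubes(6) _ 8]) 
      (use product in \<open>simp_all add: ef cubes power2_eq_square power3_eq_cube mult_ac\<close>)
  next
    case 9
    show ?thesis by (rule diag[OF 9 cubes(5,6)]) 
      (use product in \<open>simp_all add: ef cubes power2_eq_square power3_eq_cube mult_ac\<close>)
  qed
qed

section \<open>Intersection multiplicities with lines\<close>

text \<open>
  A form that vanishes to order \<open>n\<close> at \<open>v\<close> has its first \<open>n\<close> Taylor coefficients equal to zero. If the
  whole restriction vanishes, its order is meaningless but all coefficients are zero, so the
  conclusion covers that possibility too.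
\<close>

lemma intersection_mult_posD:
  assumes "L \<in> proj_lines" "v \<noteq> 0" "n \<le> intersection_mult L (homog v)" "0 < n" "n \<le> 3"
  shows "v \<in> L" and "w \<in> L \<Longrightarrow> w \<notin> homog v \<Longrightarrow> \<forall>i<n. Polynomial.coeff (fermat_along v w) i = 0"
proof -
  have "homog v \<subseteq> L" using assms by (auto simp: intersection_mult_def split: if_splits)
  then show vL: "v \<in> L" by (auto simp: homog_def vec.span_base)
  assume w: "w \<in> L" "w \<notin> homog v"
  have le: "n \<le> Polynomial.order 0 (fermat_along v w)"
    using intersection_mult_eq[OF assms(1) vL assms(2) w] assms(3) by simp
  have "Polynomial.coeff (fermat_along v w) i = 0" if "i < n" for i
  proof -
    obtain a b c d where f: "fermat_along v w = [:a, b, c, d:]" using fermat_along_coeffs by blast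
    show ?thesis
    proof (cases "fermat_along v w = 0")
      case False
      then have "n \<le> (if a \<noteq> 0 then 0 else if b \<noteq> 0 then 1 else if c \<noteq> 0 then 2 else 3)"
        using le order_0_cubic[of a b c d] f by simp
      then have abc: "0 < n \<Longrightarrow> a = 0" "1 < n \<Longrightarrow> b = 0" "2 < n \<Longrightarrow> c = 0"
        by (simp_all split: if_splits)
      consider "i = 0" | "i = 1" | "i = 2" using \<open>i < n\<close> \<open>n \<le> 3\<close> by linarith
      then show ?thesis using \<open>i < n\<close> abc
        unfolding f by cases (simp_all add: numeral_2_eq_2)
    qed simp
  qed
  then show "\<forall>i<n. Polynomial.coeff (fermat_along v w) i = 0" by blast
qed

lemma proj_line_other_vector:
  assumes "L \<in> proj_lines"
  obtains w where "w \<in> L" "w \<notin> homog v"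
proof -
  have "\<not> L \<subseteq> homog v"
  proof
    assume "L \<subseteq> homog v"
    then have "vec.dim L \<le> vec.dim (homog v)" by (rule vec.dim_subset)
    also have "\<dots> \<le> card {v}" unfolding homog_def vec.dim_span by (rule vec.dim_le_card') simp
    finally show False using assms by (simp add: proj_lines_def)
  qed
  then show ?thesis using that by blast
qed

text \<open>
  If no coordinate of \<open>v\<close> vanishes, put \<open>r i = w$i / v$i\<close>. The three vanishing coefficients say that
  \<open>\<Sum>v$i\<^sup>3\<close>, \<open>\<Sum>v$i\<^sup>3 r i\<close> and \<open>\<Sum>v$i\<^sup>3 (r i)\<^sup>2\<close> are zero. By the Vandermonde argument the \<open>r i\<close> cannot
  be distinct, and then they must all agree; so \<open>w\<close> is a multiple of \<open>v\<close>.
\<close>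

lemma flex_vanishing_coordinate:
  assumes "fermat_flex (homog v)" "v \<noteq> 0"
  shows "v$1 * v$2 * v$3 = 0"
proof (rule ccontr)
  assume "v$1 * v$2 * v$3 \<noteq> 0"
  then have nz: "v$1 \<noteq> 0" "v$2 \<noteq> 0" "v$3 \<noteq> 0" by auto
  obtain L where L: "L \<in> proj_lines" "3 \<le> intersection_mult L (homog v)"
    using assms(1) by (auto simp: fermat_flex_def)
  obtain w where w: "w \<in> L" "w \<notin> homog v" using proj_line_other_vector[OF L(1)] by blast
  have "\<forall>i<3. Polynomial.coeff (fermat_along v w) i = 0"
    using intersection_mult_posD(2)[OF L(1) assms(2) L(2)] w by simp
  then have "Polynomial.coeff (fermat_along v w) 0 = 0" "Polynomial.coeff (fermat_along v w) 1 = 0"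
    "Polynomial.coeff (fermat_along v w) 2 = 0" by auto
  then have c12: "3 * (v$1^2 * w$1 + v$2^2 * w$2 + v$3^2 * w$3) = 0"
    "3 * (v$1 * w$1^2 + v$2 * w$2^2 + v$3 * w$3^2) = 0"
    and c0: "v$1^3 + v$2^3 + v$3^3 = 0"
    unfolding fermat_along_coeffs
    by (simp_all only: One_nat_def numeral_2_eq_2 coeff_pCons_Suc coeff_pCons_0)
  then have eqs: "v$1^3 + v$2^3 + v$3^3 = 0" "v$1^2 * w$1 + v$2^2 * w$2 + v$3^2 * w$3 = 0"
    "v$1 * w$1^2 + v$2 * w$2^2 + v$3 * w$3^2 = 0"
    by (simp_all only: mult_eq_0_iff) simp_all
  define r where "r i = w$i / v$i" for i
  have r: "w$i = r i * v$i" for i using nz exhaust_3[of i] by (auto simp: r_def)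
  \<comment> \<open>Summing \<open>v$i\<^sup>3 q(r i)\<close> for a quadratic \<open>q\<close> that vanishes at two of the \<open>r i\<close> isolates the third term.\<close>
  have "v$1^3 * ((r 1 - r 2) * (r 1 - r 3)) = 0" "v$2^3 * ((r 2 - r 1) * (r 2 - r 3)) = 0"
    "v$3^3 * ((r 3 - r 1) * (r 3 - r 2)) = 0"
    using eqs unfolding r by Groebner_Basis.algebra+
  then have "r 1 = r 2 \<or> r 1 = r 3" "r 2 = r 1 \<or> r 2 = r 3" "r 3 = r 1 \<or> r 3 = r 2"
    using nz by (simp_all only: mult_eq_0_iff power_eq_0_iff right_minus_eq simp_thms)
  then have "r 1 = r 2 \<and> r 1 = r 3" by metis
  then have "w$1 = r 1 * v$1" "w$2 = r 1 * v$2" "w$3 = r 1 * v$3"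
    using r[of 1] r[of 2] r[of 3] by metis+
  then have "w = r 1 *s v" by (simp add: vec_eq_iff forall_3)
  then show False using w(2) by (auto simp: homog_def vec.span_singleton)
qed

lemma homog_scale:
  assumes "c \<noteq> 0"
  shows "homog (c *s v) = homog v"
proof
  show "homog (c *s v) \<subseteq> homog v"
    by (auto simp: homog_def vec.span_singleton)
  show "homog v \<subseteq> homog (c *s v)"
  proof
    fix u assume "u \<in> homog v"
    then obtain k where "u = k *s v" by (auto simp: homog_def vec.span_singleton)
    then have "u = (k / c) *s (c *s v)" using assms by simp
    then show "u \<in> homog (c *s v)" unfolding homog_def vec.span_singleton by blast
  qed
qed

lemma fermat_cubicE:
  assumes "P \<in> fermat_cubic"
  obtains v where "v \<noteq> 0" "P = homog v" "v$1^3 + v$2^3 + v$3^3 = 0"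
  using assms unfolding fermat_cubic_def fermat_form_def by blast

lemma homog_in_fermat_cubicD:
  assumes "homog v \<in> fermat_cubic" "v \<noteq> 0"
  shows "v$1^3 + v$2^3 + v$3^3 = 0"
proof -
  obtain u where u: "homog v = homog u" "u$1^3 + u$2^3 + u$3^3 = 0"
    using fermat_cubicE[OF assms(1)] by metis
  have "v \<in> homog u" using u(1)[symmetric] by (simp add: homog_def vec.span_base)
  then obtain c where "v = c *s u" by (auto simp: homog_def vec.span_singleton)
  then have "v$1^3 + v$2^3 + v$3^3 = c^3 * (u$1^3 + u$2^3 + u$3^3)"
    by (simp add: power_mult_distrib algebra_simps)
  then show ?thesis by (simp only: u(2) mult_zero_right)
qed

lemma fermat_cubic_in_proj_plane: "P \<in> fermat_cubic \<Longrightarrow> P \<in> proj_plane"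
  by (auto simp: fermat_cubic_def proj_plane_def)

text \<open>
  For three distinct points, multiplicities do not matter: the third point is a combination
  of the other two with both coefficients nonzero, which is the situation of \<open>chord_through_flex\<close>.
\<close>

lemma third_point_flex_reflected:
  assumes L: "L \<in> proj_lines" "line_section L {#T, homog v, R#}"
    and T: "fermat_flex T" and v: "v \<noteq> 0" "homog v \<in> fermat_cubic" and R: "R \<in> fermat_cubic"
    and ne: "T \<noteq> homog v" "T \<noteq> R" "homog v \<noteq> R"
  shows "\<exists>w. flex_reflected v w \<and> R = homog w"
proof -
  obtain a where a: "a \<noteq> 0" "T = homog a" "a$1^3 + a$2^3 + a$3^3 = 0"
    using T fermat_cubicE by (metis fermat_flex_def)
  obtain c where c: "c \<noteq> 0" "R = homog c" "c$1^3 + c$2^3 + c$3^3 = 0"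
    using R fermat_cubicE by metis
  have Fv: "v$1^3 + v$2^3 + v$3^3 = 0" by (rule homog_in_fermat_cubicD[OF v(2,1)])
  have on_L: "u \<in> L" if "u \<noteq> 0" "homog u \<in># {#T, homog v, R#}" for u
  proof -
    have "homog u \<in> proj_plane" using that(1) by (auto simp: proj_plane_def)
    then have "intersection_mult L (homog u) = count {#T, homog v, R#} (homog u)"
      using L(2) by (simp add: line_section_def)
    also have "\<dots> \<ge> 1" using that(2) by (metis count_greater_eq_one_iff)
    finally show ?thesis using intersection_mult_posD(1)[OF L(1) that(1), of 1] by simp
  qed
  have vL: "v \<in> L" and aL: "a \<in> L" and cL: "c \<in> L"
    using on_L[of v] on_L[of a] on_L[of c] a c v by auto
  have notin: "u \<notin> homog u'" if "u \<noteq> 0" "homog u \<noteq> homog u'" for u u' :: "complex ^ 3"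
  proof
    assume "u \<in> homog u'"
    then obtain k where "u = k *s u'" by (auto simp: homog_def vec.span_singleton)
    then show False using that homog_scale[of k u'] by auto
  qed
  have "v \<notin> homog a" using notin v(1) ne(1) a(2) by metis
  then have "L = vec.span {a, v}" using proj_line_spanned[OF L(1) aL a(1) vL] by simp
  with cL obtain s where "c - s *s a \<in> vec.span {v}" by (auto simp: vec.span_insert)
  then obtain t where "c - s *s a = t *s v" by (auto simp: vec.span_singleton)
  then have cst: "c = s *s a + t *s v" by (simp add: algebra_simps)
  have t: "t \<noteq> 0" using cst c ne(2) a(2) homog_scale[of s a] by auto
  have s: "s \<noteq> 0" using cst c ne(3) homog_scale[of t v] by auto
  have cs: "c$i = s * a$i + t * v$i" for i using cst by simp
  have nk: "\<not> (v$1 = k * a$1 \<and> v$2 = k * a$2 \<and> v$3 = k * a$3)" for k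
  proof
    assume "v$1 = k * a$1 \<and> v$2 = k * a$2 \<and> v$3 = k * a$3"
    then have "v = k *s a" by (simp add: vec_eq_iff forall_3)
    then show False using \<open>v \<notin> homog a\<close> by (auto simp: homog_def vec.span_singleton)
  qed
  have "\<exists>w. flex_reflected v w \<and> c = t *s w"
  proof -
    have "a$1 * a$2 * a$3 = 0" using flex_vanishing_coordinate T a by simp
    moreover have "a$1 \<noteq> 0 \<or> a$2 \<noteq> 0 \<or> a$3 \<noteq> 0" using a(1) by (auto simp: vec_eq_iff forall_3)
    ultimately consider (1) "a$1 = 0" "a$2 \<noteq> 0" | (2) "a$2 = 0" "a$1 \<noteq> 0" | (3) "a$3 = 0" "a$1 \<noteq> 0"
      using a(3) by (cases "a$1 = 0"; cases "a$2 = 0") auto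
    then show ?thesis
    proof cases
      case 1
      obtain e where "e^3 = 1" "c$1 = t * v$1" "c$2 = t * (e^2 * v$3)" "c$3 = t * (e * v$2)"
        using chord_through_flex[of "a$2" "a$3" "v$1" "v$2" "v$3" "c$1" "c$2" "c$3" t s]
          1 a(3) Fv c(3) cs s t nk by auto
      then show ?thesis
        by (intro exI[of _ "vector [v$1, e^2 * v$3, e * v$2]"] conjI)
           (auto simp: flex_reflected_def vec_eq_iff forall_3)
    next
      case 2
      obtain e where "e^3 = 1" "c$2 = t * v$2" "c$1 = t * (e^2 * v$3)" "c$3 = t * (e * v$1)"
        using chord_through_flex[of "a$1" "a$3" "v$2" "v$1" "v$3" "c$2" "c$1" "c$3" t s]
          2 a(3) Fv c(3) cs s t nk by (auto simp: add_ac)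
      then show ?thesis
        by (intro exI[of _ "vector [e^2 * v$3, v$2, e * v$1]"] conjI)
           (auto simp: flex_reflected_def vec_eq_iff forall_3)
    next
      case 3
      obtain e where "e^3 = 1" "c$3 = t * v$3" "c$1 = t * (e^2 * v$2)" "c$2 = t * (e * v$1)"
        using chord_through_flex[of "a$1" "a$2" "v$3" "v$1" "v$2" "c$3" "c$1" "c$2" t s]
          3 a(3) Fv c(3) cs s t nk by (auto simp: add_ac)
      then show ?thesis
        by (intro exI[of _ "vector [e^2 * v$2, e * v$1, v$3]"] conjI)
           (auto simp: flex_reflected_def vec_eq_iff forall_3)
    qed
  qed
  then show ?thesis using c(2) homog_scale[OF t] by auto
qed

text \<open>
  The equation says that \<open>w\<close> is annihilated by the gradient \<open>3(v$1\<^sup>2, v$2\<^sup>2, v$3\<^sup>2)\<close> of the Fermat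
  form at \<open>v\<close>.
\<close>

lemma tangent_section:
  assumes L: "L \<in> proj_lines" "line_section L {#homog v, homog v, homog w#}"
    and nz: "v \<noteq> 0" "w \<noteq> 0" and ne: "homog w \<noteq> homog v"
  shows "v$1^2 * w$1 + v$2^2 * w$2 + v$3^2 * w$3 = 0"
proof -
  have "homog v \<in> proj_plane" "homog w \<in> proj_plane" using nz by (auto simp: proj_plane_def)
  then have "intersection_mult L (homog v) = 2" "intersection_mult L (homog w) = 1"
    using L(2) ne by (auto simp: line_section_def)
  then have wL: "w \<in> L" and c: "w \<notin> homog v \<Longrightarrow> \<forall>i<2. Polynomial.coeff (fermat_along v w) i = 0"
    using intersection_mult_posD(1)[OF L(1) nz(2), of 1] intersection_mult_posD(2)[OF L(1) nz(1), of 2 w]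
    by auto
  have "w \<notin> homog v"
  proof
    assume "w \<in> homog v"
    then obtain k where "w = k *s v" by (auto simp: homog_def vec.span_singleton)
    then show False using nz ne homog_scale[of k v] by auto
  qed
  then have "Polynomial.coeff (fermat_along v w) 1 = 0" using c by simp
  then have "3 * (v$1^2 * w$1 + v$2^2 * w$2 + v$3^2 * w$3) = 0"
    unfolding fermat_along_coeffs by (simp only: One_nat_def coeff_pCons_Suc coeff_pCons_0)
  then show ?thesis by (simp only: mult_eq_0_iff) simp
qed

section \<open>Type 9 points\<close>

text \<open>
  Here \<open>w\<close> represents \<open>-P\<close> and \<open>u\<close> represents \<open>-2P\<close>. As \<open>P\<close> has order exactly 9, equalities between
  multiples of \<open>P\<close> are congruences modulo 9, and this settles all the distinctness conditions for the
  lines through \<open>O, P, -P\<close>, through \<open>3P, -P, -2P\<close>, and tangent at \<open>P\<close> through \<open>-2P\<close>.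
\<close>

lemma type9_point_tangent_condition:
  assumes G: "fermat_group_law G" and P: "type9_point G P"
  obtains v w u where "v \<noteq> 0" "P = homog v" "v$1^3 + v$2^3 + v$3^3 = 0"
    "flex_reflected v w" "flex_reflected w u" "homog u \<noteq> homog v"
    "v$1^2 * u$1 + v$2^2 * u$2 + v$3^2 * u$3 = 0"
proof -
  interpret comm_group G using G by (simp add: fermat_group_law_def)
  have car: "carrier G = fermat_cubic" and flex1: "fermat_flex \<one>\<^bsub>G\<^esub>"
    using G by (auto simp: fermat_group_law_def)
  have line: "\<exists>L\<in>proj_lines. line_section L {#A, B, C#}"
    if "A \<in> carrier G" "B \<in> carrier G" "C \<in> carrier G" "A \<otimes>\<^bsub>G\<^esub> B \<otimes>\<^bsub>G\<^esub> C = \<one>\<^bsub>G\<^esub>" for A B C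
    using G that by (simp add: fermat_group_law_def)
  have Pc: "P \<in> carrier G" and P9: "P [^]\<^bsub>G\<^esub> (9::nat) = \<one>\<^bsub>G\<^esub>" and P3: "P [^]\<^bsub>G\<^esub> (3::nat) \<noteq> \<one>\<^bsub>G\<^esub>"
    using P car by (auto simp: type9_point_def)
  \<comment> \<open>The multiple \<open>kP\<close> in additive notation.\<close>
  define p where "p k = P [^]\<^bsub>G\<^esub> (k::int)" for k
  have pc: "p k \<in> carrier G" for k using Pc by (simp add: p_def)
  have pm: "p i \<otimes>\<^bsub>G\<^esub> p j = p (i + j)" for i j using Pc by (simp add: p_def int_pow_mult)
  have p0: "p 0 = \<one>\<^bsub>G\<^esub>" by (simp add: p_def)
  have P1: "P = p 1" using Pc by (simp add: p_def)
  have ord: "ord P = 9"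
  proof -
    have "ord P dvd 3 ^ 2" using P9 pow_eq_id[OF Pc] by simp
    moreover have "\<not> ord P dvd 3" using P3 pow_eq_id[OF Pc] by simp
    ultimately obtain i where "i \<le> 2" "ord P = 3 ^ i" "\<not> ord P dvd 3"
      using divides_primepow_nat[of 3 "ord P" 2] by auto
    moreover from this have "i = 2" by (cases "i = 0"; cases "i = 1") auto
    ultimately show ?thesis by simp
  qed
  have peq: "p i = p j \<longleftrightarrow> 9 dvd (i - j)" for i j
  proof -
    have "p i = p j \<longleftrightarrow> p (i - j) = \<one>\<^bsub>G\<^esub>"
      using pm[of "i - j" j] pc[of j] pc[of "i - j"] by (auto intro: l_cancel_one'[THEN iffD1])
    then show ?thesis using int_pow_eq_id[OF Pc, of "i - j"] ord by (simp add: p_def)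
  qed
  have flexT: "fermat_flex (p 3)"
  proof -
    have "p 3 \<otimes>\<^bsub>G\<^esub> p 3 \<otimes>\<^bsub>G\<^esub> p 3 = \<one>\<^bsub>G\<^esub>" by (simp add: pm flip: p0) (simp add: peq)
    then obtain L where L: "L \<in> proj_lines" "line_section L {#p 3, p 3, p 3#}" using line pc by blast
    then have "intersection_mult L (p 3) = 3"
      using pc[of 3] fermat_cubic_in_proj_plane car by (simp add: line_section_def)
    then show ?thesis using L(1) pc[of 3] car
      unfolding fermat_flex_def by (intro conjI bexI[of _ L]) simp_all
  qed
  have reflect: "\<exists>w. flex_reflected v w \<and> p k = homog w"
    if hyps: "fermat_flex (p i)" "v \<noteq> 0" "p j = homog v" "9 dvd (i + j + k)"
      "\<not> 9 dvd (i - j)" "\<not> 9 dvd (i - k)" "\<not> 9 dvd (j - k)" for i j k v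
  proof -
    have "p i \<otimes>\<^bsub>G\<^esub> p j \<otimes>\<^bsub>G\<^esub> p k = \<one>\<^bsub>G\<^esub>" using hyps(4) by (simp add: pm peq flip: p0)
    then obtain L where "L \<in> proj_lines" "line_section L {#p i, homog v, p k#}"
      using line pc hyps(3) by metis
    then show ?thesis
      using third_point_flex_reflected[of L "p i" v "p k"] hyps pc car peq by metis
  qed
  obtain v where v: "v \<noteq> 0" "p 1 = homog v" "v$1^3 + v$2^3 + v$3^3 = 0"
    using fermat_cubicE[of "p 1"] pc car by metis
  obtain w where w: "flex_reflected v w" "p (- 1) = homog w"
    using reflect[of 0 v 1 "- 1"] flex1 v p0 by auto
  have nonzero: "a \<noteq> 0" if "p k = homog a" for k a
  proof
    assume "a = 0"
    obtain b where b: "b \<noteq> 0" "p k = homog b" using fermat_cubicE[of "p k"] pc car by metis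
    then have "b \<in> homog a" using that by (simp add: homog_def vec.span_base flip: b(2))
    then show False using \<open>a = 0\<close> b(1) by (simp add: homog_def)
  qed
  obtain u where u: "flex_reflected w u" "p (- 2) = homog u"
    using reflect[of 3 w "- 1" "- 2"] flexT w nonzero by auto
  have ne: "homog u \<noteq> homog v" using peq[of "- 2" 1] u v by simp
  have "p 1 \<otimes>\<^bsub>G\<^esub> p 1 \<otimes>\<^bsub>G\<^esub> p (- 2) = \<one>\<^bsub>G\<^esub>" by (simp add: pm p0)
  then obtain L where "L \<in> proj_lines" "line_section L {#homog v, homog v, homog u#}"
    using line pc v(2) u(2) by metis
  then have "v$1^2 * u$1 + v$2^2 * u$2 + v$3^2 * u$3 = 0"
    using tangent_section v(1) nonzero u(2) ne by blast
  with v w u ne P1 show thesis using that by metis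
qed

theorem theorem1:
  fixes G :: "(complex ^ 3) set monoid" and P :: "(complex ^ 3) set" and \<alpha> \<beta> :: complex
  assumes "fermat_group_law G"
    and "type9_point G P"
    and "\<alpha> = complex_of_real (root 3 3)"
    and "primitive_root_of_unity 9 \<beta>"
  shows "\<exists>a\<in>rat_adjoin {\<alpha>, \<beta>}. \<exists>b\<in>rat_adjoin {\<alpha>, \<beta>}. \<exists>c\<in>rat_adjoin {\<alpha>, \<beta>}.
           vector [a, b, c] \<noteq> (0 :: complex ^ 3) \<and> P = homog (vector [a, b, c])"
proof -
  let ?K = "rat_adjoin {\<alpha>, \<beta>}"
  have "\<alpha> ^ 3 = complex_of_real (root 3 3 ^ 3)" using assms(3) by (simp only: of_real_power)
  then have \<alpha>: "\<alpha> ^ 3 = 3" "\<alpha> \<in> ?K" by (simp_all add: rat_adjoin_incl)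
  have \<beta>: "\<beta> ^ 6 + \<beta> ^ 3 + 1 = 0" "\<beta> \<in> ?K"
    using primitive_9th_root_cyclotomic[OF assms(4)] by (simp_all add: rat_adjoin_incl)
  obtain v w u where v: "v \<noteq> 0" "P = homog v" and F: "v$1^3 + v$2^3 + v$3^3 = 0"
    and refl: "flex_reflected v w" "flex_reflected w u" and ne: "homog u \<noteq> homog v"
    and T: "v$1^2 * u$1 + v$2^2 * u$2 + v$3^2 * u$3 = 0"
    using type9_point_tangent_condition[OF assms(1,2)] by metis
  have nz: "v$1 \<noteq> 0 \<or> v$2 \<noteq> 0 \<or> v$3 \<noteq> 0" using v(1) by (auto simp: vec_eq_iff forall_3)
  from refl have "\<exists>s. s \<noteq> 0 \<and> s * v$1 \<in> ?K \<and> s * v$2 \<in> ?K \<and> s * v$3 \<in> ?K"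
  proof (cases rule: flex_reflected_twice)
    case (diagonal c \<eta>)
    \<comment> \<open>Otherwise \<open>-2P = P\<close>, that is, \<open>3P = O\<close>.\<close>
    have "\<eta> \<noteq> 1"
    proof
      assume "\<eta> = 1"
      then have "u = c *s v" using diagonal(3) by (simp add: vec_eq_iff forall_3)
      then show False using ne homog_scale[OF diagonal(2)] by simp
    qed
    have "c * (v$1^3 + \<eta> * v$2^3 + \<eta>^2 * v$3^3) = 0"
      using T unfolding diagonal(3) by (simp add: power2_eq_square power3_eq_cube algebra_simps)
    then have "v$1^3 + \<eta> * v$2^3 + \<eta>^2 * v$3^3 = 0" using diagonal(2) by simp
    then show ?thesis
      by (rule diagonal_intersection_rational[OF \<beta> nz F diagonal(1) \<open>\<eta> \<noteq> 1\<close>])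
  next
    case (cyclic a b c)
    have "a * (v$1^2 * v$2) + b * (v$2^2 * v$3) + c * (v$3^2 * v$1) = 0"
      using T unfolding cyclic(5) by (simp add: algebra_simps)
    then show ?thesis
      by (rule twisted_cyclic_intersection_rational[OF \<alpha> \<beta> nz F cyclic(1,2,4)])
  next
    case (anticyclic a b c)
    \<comment> \<open>Exchanging the second and third coordinates reduces this to the other cyclic order.\<close>
    have "a * (v$1^2 * v$3) + c * (v$3^2 * v$2) + b * (v$2^2 * v$1) = 0"
      using T unfolding anticyclic(5) by (simp add: algebra_simps)
    moreover have "v$1 \<noteq> 0 \<or> v$3 \<noteq> 0 \<or> v$2 \<noteq> 0" "v$1^3 + v$3^3 + v$2^3 = 0" "a * c * b = 1"
      using nz F anticyclic(4) by (auto simp: ac_simps)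
    ultimately show ?thesis
      using twisted_cyclic_intersection_rational[OF \<alpha> \<beta>, of "v$1" "v$3" "v$2" a c b] anticyclic(1,3)
      by blast
  qed
  then obtain s where s: "s \<noteq> 0" "s * v$1 \<in> ?K" "s * v$2 \<in> ?K" "s * v$3 \<in> ?K" by blast
  have sv: "vector [s * v$1, s * v$2, s * v$3] = s *s v" by (simp add: vec_eq_iff forall_3)
  have "vector [s * v$1, s * v$2, s * v$3] \<noteq> (0 :: complex ^ 3)" using sv s(1) v(1) by simp
  moreover have "P = homog (vector [s * v$1, s * v$2, s * v$3])"
    using sv homog_scale[OF s(1)] v(2) by simp
  ultimately show ?thesis using s by blast
qed

end
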